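(* Let $p, r, n$ be positive integers, let $a_0,\dots,a_n$ and $x$ be real numbers with $a_n\in\mathbb{F}$, let $P(x)=\sum_{i=0}^n a_i x^i$, and assume $P(x)\neq 0$. Let $\widehat{P}(x)$ be the random value computed by Horner's algorithm when every arithmetic operation is rounded with limited-precision stochastic rounding $\mathrm{SR}_{p,r}$, that is, $\widehat{P}(x)=\widehat r_{2n}$ where $$\widehat r_0=a_n,\qquad \widehat r_{2k-1}=\mathrm{SR}_{p,r}(\widehat r_{2k-2}\,x),\qquad \widehat r_{2k}=\mathrm{SR}_{p,r}(\widehat r_{2k-1}+a_{n-k}),\qquad k=1,\dots,n.$$ Then for any $0<\lambda<1$, with probability at least $1-\lambda$, $$\frac{|\widehat P(x)-P(x)|}{|P(x)|}\le \kappa(P)\left(\sqrt{u_p\,\gamma_{4n}(u_p)}\,\sqrt{\ln(2/\lambda)}+\gamma_{2n}(u_p+u_{p+r})-\gamma_{2n}(u_p)\right),$$ where $$\kappa(P)=\frac{\sum_{i=0}^n |a_i|\,|x|^i}{\left|\sum_{i=0}^n a_i x^i\right|}.$$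
   Context: Notation: $u_k:=2^{1-k}$ for a positive integer $k$, and $\gamma_m(u):=(1+u)^m-1$. Floating-point system: $\mathbb{F}\subset\mathbb{R}$ is the binary floating-point number system with $p$ significant bits, with underflow and overflow ignored, i.e. $\mathbb{F}=\{m\,2^e : m,e\in\mathbb{Z},\ |m|<2^p\}$ (this includes $0$). For $y\in\mathbb{R}$, let $\lceil y\rceil_p=\min\{z\in\mathbb{F}: z\ge y\}$ and $\lfloor y\rfloor_p=\max\{z\in\mathbb{F}: z\le y\}$ denote the neighbouring precision-$p$ floating-point numbers. Let $\mathrm{fl}_{p+r}(y)$ denote $y$ with its binary representation truncated (rounded toward zero) to its first $p+r$ significant binary digits, with $\mathrm{fl}_{p+r}(0)=0$. Limited-precision stochastic rounding with $r$ random bits: for $y\in\mathbb{R}\setminus\mathbb{F}$, $\mathrm{SR}_{p,r}(y)$ is the two-valued random variable equal to $\lceil y\rceil_p$ with probability $q_r(y)$ and to $\lfloor y\rfloor_p$ with probability $1-q_r(y)$, where $$q_r(y)=\frac{\mathrm{fl}_{p+r}(y)-\lfloor y\rfloor_p}{\lceil y\rceil_p-\lfloor y\rfloor_p}.$$ For $y\in\mathbb{F}$, $\mathrm{SR}_{p,r}(y)=y$. In a sequence of operations, each rounding uses fresh randomness independent of that used by all the other roundings: conditionally on the outcomes of all previous roundings, the result of rounding the (then determined) exact result $y$ of the current operation has the distribution of $\mathrm{SR}_{p,r}(y)$ given above. *)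

theory Defs
  imports "HOL-Probability.Probability"
begin

definition unit_roundoff :: "nat \<Rightarrow> real" where
  "unit_roundoff k = 2 powi (1 - int k)"

definition gam :: "nat \<Rightarrow> real \<Rightarrow> real" where
  "gam m u = (1 + u) ^ m - 1"

definition floats :: "nat \<Rightarrow> real set" where
  "floats p = {of_int m * 2 powi e | (m :: int) (e :: int). \<bar>m\<bar> < 2 ^ p}"

definition float_up :: "nat \<Rightarrow> real \<Rightarrow> real" where
  "float_up p y = (LEAST z. z \<in> floats p \<and> y \<le> z)"

definition float_down :: "nat \<Rightarrow> real \<Rightarrow> real" where
  "float_down p y = (GREATEST z. z \<in> floats p \<and> z \<le> y)"

text \<open>
  Truncation towards zero to the first \<open>q\<close> significant binary digits. For \<open>y \<noteq> 0\<close> the leading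
  binary digit of \<open>\<bar>y\<bar>\<close> has weight \<open>2 powi e\<close> with \<open>e = \<lfloor>log 2 \<bar>y\<bar>\<rfloor>\<close>, hence the \<open>q\<close>-th one has
  weight \<open>2 powi (e - q + 1)\<close>. For \<open>y = 0\<close> the factor \<open>sgn y\<close> makes the result \<open>0\<close>.
\<close>

definition fl_trunc :: "nat \<Rightarrow> real \<Rightarrow> real" where
  "fl_trunc q y =
     (let w = 2 powi (\<lfloor>log 2 \<bar>y\<bar>\<rfloor> - int q + 1)
      in sgn y * (of_int \<lfloor>\<bar>y\<bar> / w\<rfloor> * w))"

definition up_prob :: "nat \<Rightarrow> nat \<Rightarrow> real \<Rightarrow> real" where
  "up_prob p r y = (fl_trunc (p + r) y - float_down p y) / (float_up p y - float_down p y)"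

text \<open>
  For \<open>p > 0\<close> and \<open>y \<notin> floats p\<close>, the truncation of \<open>y\<close> to \<open>p + r\<close> digits stays between the two
  neighbouring precision-\<open>p\<close> numbers, so \<open>up_prob p r y\<close> lies in \<open>[0, 1]\<close> and is not clipped by
  \<open>bernoulli_pmf\<close>.
\<close>

definition SR :: "nat \<Rightarrow> nat \<Rightarrow> real \<Rightarrow> real pmf" where
  "SR p r y =
     (if y \<in> floats p then return_pmf y
      else map_pmf (\<lambda>b. if b then float_up p y else float_down p y)
             (bernoulli_pmf (up_prob p r y)))"

text \<open>
  The law of the \<open>k\<close>-th Horner iterate (\<open>k\<close> multiplications and \<open>k\<close> additions, each rounded).
  Monadic sequencing expresses that, conditionally on all previous roundings, the next one is
  distributed as \<open>SR p r y\<close>, where \<open>y\<close> is the exact result of the current operation.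
\<close>

primrec horner_SR :: "nat \<Rightarrow> nat \<Rightarrow> nat \<Rightarrow> (nat \<Rightarrow> real) \<Rightarrow> real \<Rightarrow> nat \<Rightarrow> real pmf" where
  "horner_SR p r n a x 0 = return_pmf (a n)"
| "horner_SR p r n a x (Suc k) =
     do {
       s \<leftarrow> horner_SR p r n a x k;
       t \<leftarrow> SR p r (s * x);
       SR p r (t + a (n - Suc k))
     }"

definition poly_val :: "nat \<Rightarrow> (nat \<Rightarrow> real) \<Rightarrow> real \<Rightarrow> real" where
  "poly_val n a x = (\<Sum>i\<le>n. a i * x ^ i)"

definition cond_number :: "nat \<Rightarrow> (nat \<Rightarrow> real) \<Rightarrow> real \<Rightarrow> real" where
  "cond_number n a x = (\<Sum>i\<le>n. \<bar>a i\<bar> * \<bar>x\<bar> ^ i) / \<bar>\<Sum>i\<le>n. a i * x ^ i\<bar>"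

end

theory Submission imports Defs begin

text \<open>
  Write \<open>u = u\<^sub>p\<close>, \<open>v = u\<^sub>p\<^sub>+\<^sub>r\<close> and \<open>H = \<Sum> \<bar>a\<^sub>i\<bar> \<bar>x\<bar>\<^sup>i\<close>. The operations of Horner's scheme are affine in
  the running value, so the local error of the \<open>k\<close>-th operation reaches the final result multiplied
  exactly by a power of \<open>x\<close>; this contribution is at most \<open>u H (1 + u)\<^sup>k\<^sup>-\<^sup>1\<close> in size, and its
  conditional mean at most \<open>v H (1 + u)\<^sup>k\<^sup>-\<^sup>1\<close>. The means add up to at most
  \<open>v H \<Sum>\<^sub>k (1 + u)\<^sup>k\<^sup>-\<^sup>1 \<le> H (\<gamma>\<^sub>2\<^sub>n(u + v) - \<gamma>\<^sub>2\<^sub>n(u))\<close>, and the fluctuations are controlled as in the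
  Azuma-Hoeffding inequality, where \<open>\<Sum>\<^sub>k u\<^sup>2 (1 + u)\<^sup>2\<^sup>k\<^sup>-\<^sup>2 = u \<gamma>\<^sub>4\<^sub>n(u) / (2 + u)\<close>. Instead of splitting off
  the martingale part, the proof bounds the moment generating function of the whole error at every
  \<open>l\<close>; the bias then appears as a separate term linear in \<open>\<bar>l\<bar>\<close>.
\<close>


section \<open>Neighbouring floating-point numbers and truncation\<close>

lemma floats_uminus_iff: "- z \<in> floats p \<longleftrightarrow> z \<in> floats p"
proof -
  have "- z \<in> floats p" if "z \<in> floats p" for z
  proof -
    from that obtain m e where "z = of_int m * 2 powi e" "\<bar>m\<bar> < 2 ^ p"
      unfolding floats_def by blast
    then have "- z = of_int (- m) * 2 powi e" "\<bar>- m\<bar> < 2 ^ p" by auto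
    then show ?thesis unfolding floats_def by blast
  qed
  from this[of z] this[of "- z"] show ?thesis by auto
qed

lemma float_up_eqI:
  assumes "z \<in> floats p" "y \<le> z" "\<And>z'. z' \<in> floats p \<Longrightarrow> y \<le> z' \<Longrightarrow> z \<le> z'"
  shows "float_up p y = z"
  unfolding float_up_def by (rule Least_equality) (use assms in auto)

lemma float_down_eqI:
  assumes "z \<in> floats p" "z \<le> y" "\<And>z'. z' \<in> floats p \<Longrightarrow> z' \<le> y \<Longrightarrow> z' \<le> z"
  shows "float_down p y = z"
  unfolding float_down_def by (rule Greatest_equality) (use assms in auto)

lemma fl_trunc_uminus: "fl_trunc q (- y) = - fl_trunc q y"
  by (simp add: fl_trunc_def Let_def)

lemma two_powi_add: "2 powi a * 2 powi b = (2::real) powi (a + b)"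
  by (simp add: power_int_add)

text \<open>A significand below \<open>2 ^ p\<close> can reach \<open>2 powi e\<close> only with an
  exponent of at least \<open>e - p + 1\<close>, so the number lies on the grid of that
  spacing.\<close>

lemma floats_multiple_of_ulp:
  assumes "z \<in> floats p" "2 powi e \<le> z"
  obtains k :: int where "z = of_int k * 2 powi (e - int p + 1)"
proof -
  obtain m f where z: "z = of_int m * 2 powi f" and m: "\<bar>m\<bar> < 2 ^ p"
    using assms(1) unfolding floats_def by blast
  have "real_of_int m < 2 powi int p" using m
    by (metis abs_ge_self le_less_trans of_int_less_iff of_int_numeral of_int_power power_int_of_nat)
  then have "z < 2 powi int p * 2 powi f" unfolding z by simp
  with assms(2) have "2 powi e < (2::real) powi (int p + f)" by (simp add: power_int_add)
  then have "e < int p + f" by (meson less_le_not_le linorder_not_le one_le_numeral power_int_increasing)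
  then obtain j :: nat where j: "f = int j + (e - int p + 1)"
    by (intro that[of "nat (f - (e - int p + 1))"]) simp
  have "z = of_int (m * 2 ^ j) * 2 powi (e - int p + 1)"
    unfolding z j by (simp add: power_int_add)
  then show ?thesis using that by blast
qed

text \<open>In the binade \<open>[2 powi e, 2 powi (e + 1))\<close> of \<open>y\<close> the floats
  have spacing \<open>w\<close>, so the neighbours of \<open>y\<close> are \<open>k * w\<close> and
  \<open>(k + 1) * w\<close>. Truncation uses the grid of spacing \<open>v\<close>, which is
  \<open>2 ^ r\<close> times finer. Both error bounds follow from \<open>2 powi e \<le> y\<close>.
  The last two claims prepare the reduction of negative arguments to positive ones.\<close>

lemma rounding_bounds_pos:
  assumes p_pos: "p > 0" and not_float: "y \<notin> floats p" and "y > 0"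
  shows "float_down p y < y" "y < float_up p y"
    "float_up p y - float_down p y \<le> unit_roundoff p * y"
    "float_down p y \<le> fl_trunc (p + r) y" "fl_trunc (p + r) y \<le> y"
    "y - fl_trunc (p + r) y \<le> unit_roundoff (p + r) * y"
    "float_up p (- y) = - float_down p y" "float_down p (- y) = - float_up p y"
proof -
  define e where "e = \<lfloor>log 2 y\<rfloor>"
  define w where "w = (2::real) powi (e - int p + 1)"
  define v where "v = (2::real) powi (e - int (p + r) + 1)"
  define k where "k = \<lfloor>y / w\<rfloor>"
  have w: "w > 0" and v: "v > 0" by (simp_all add: w_def v_def)
  have "2 powr of_int e \<le> y"
    using \<open>y > 0\<close> le_log_iff[of 2 y "of_int e"] by (simp add: e_def)
  then have e1: "2 powi e \<le> y" by (simp add: powr_real_of_int')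
  have "y < 2 powr of_int (e + 1)"
    using \<open>y > 0\<close> log_less_iff[of 2 y "of_int (e + 1)"] by (simp add: e_def)
  then have e2: "y < 2 powi (e + 1)" by (subst (asm) powr_real_of_int') auto
  have "2 powi e = 2 powi int (p - 1) * w" "2 powi (e + 1) = 2 powi int p * w"
    unfolding w_def two_powi_add using p_pos by (simp_all add: of_nat_diff)
  then have we: "2 powi e = 2 ^ (p - 1) * w" "2 powi (e + 1) = 2 ^ p * w"
    by (simp_all only: power_int_of_nat)
  have wv: "w = 2 ^ r * v"
    using two_powi_add[of "int r" "e - int (p + r) + 1"] by (simp add: w_def v_def algebra_simps)
  have k1: "2 ^ (p - 1) \<le> k"
    using e1 w unfolding k_def we by (simp add: le_floor_iff pos_le_divide_eq)
  then have k1': "2 ^ (p - 1) \<le> (of_int k :: real)"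
    by (metis of_int_le_iff of_int_numeral of_int_power)
  have k0: "k \<ge> 0" using k1 by (rule order_trans[rotated]) simp
  have k2: "k < 2 ^ p"
    using e2 w unfolding k_def we by (simp add: floor_less_iff pos_divide_less_eq)
  have kf: "of_int k * w \<in> floats p"
    unfolding floats_def w_def using k0 k2 by (intro CollectI exI conjI refl) auto
  have kle: "of_int k * w \<le> y" using w by (simp add: k_def pos_le_divide_eq[symmetric])
  have k_less: "of_int k * w < y" using kle kf not_float by (metis less_eq_real_def)
  have lk: "y < of_int (k + 1) * w" using w by (simp add: k_def pos_divide_less_eq[symmetric])
  \<comment> \<open>If the significand overflows to \<open>2 ^ p\<close>, the upper neighbour is the
    power of two \<open>2 powi (e + 1)\<close>, which has significand 1.\<close>
  have k1f: "of_int (k + 1) * w \<in> floats p"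
  proof (cases "k + 1 = 2 ^ p")
    case True
    then have eq: "of_int (k + 1) * w = of_int 1 * 2 powi (e + 1)" by (simp only: we) simp
    show ?thesis unfolding floats_def using p_pos eq
      by (intro CollectI exI[of _ 1] exI[of _ "e + 1"]) auto
  next
    case False
    then show ?thesis unfolding floats_def using k0 k2
      by (intro CollectI exI[of _ "k + 1"] exI[of _ "e - int p + 1"]) (simp add: w_def)
  qed
  \<comment> \<open>Floats below \<open>2 powi e\<close> may lie off the grid of spacing
    \<open>w\<close>, but they are smaller than \<open>k * w\<close> because
    \<open>2 ^ (p - 1) \<le> k\<close>.\<close>
  have below: "z \<le> of_int k * w" if z: "z \<in> floats p" "z \<le> y" for z
  proof (cases "2 powi e \<le> z")
    case True
    with z(1) obtain j :: int where j: "z = of_int j * w"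
      unfolding w_def by (rule floats_multiple_of_ulp)
    then have "j \<le> k" using z(2) w by (simp add: k_def le_floor_iff pos_le_divide_eq)
    then show ?thesis using j w by simp
  next
    case False
    moreover have "2 powi e \<le> of_int k * w" unfolding we using w k1' by (intro mult_right_mono) auto
    ultimately show ?thesis by simp
  qed
  have above: "of_int (k + 1) * w \<le> z" if z: "z \<in> floats p" "y \<le> z" for z
  proof -
    have "2 powi e \<le> z" using e1 z(2) by simp
    with z(1) obtain j :: int where j: "z = of_int j * w"
      unfolding w_def by (rule floats_multiple_of_ulp)
    then have "of_int k * w < of_int j * w" using z(2) k_less by simp
    then have "k + 1 \<le> j" using w by simp
    then show ?thesis unfolding j using w
      by (intro mult_right_mono iffD2[OF of_int_le_iff]) auto
  qed
  have down: "float_down p y = of_int k * w"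
    by (rule float_down_eqI) (use kf kle below in auto)
  have up: "float_up p y = of_int (k + 1) * w"
    by (rule float_up_eqI[OF k1f]) (use lk above in auto)
  have "float_up p (- y) = - (of_int k * w)"
  proof (rule float_up_eqI)
    show "- (of_int k * w) \<in> floats p" using kf by (simp only: floats_uminus_iff)
    show "- y \<le> - (of_int k * w)" using kle by simp
    fix z assume "z \<in> floats p" "- y \<le> z"
    then have "- z \<in> floats p" "- z \<le> y" by (simp_all add: floats_uminus_iff)
    from below[OF this] show "- (of_int k * w) \<le> z" by linarith
  qed
  then show "float_up p (- y) = - float_down p y" by (simp only: down)
  have "float_down p (- y) = - (of_int (k + 1) * w)"
  proof (rule float_down_eqI)
    show "- (of_int (k + 1) * w) \<in> floats p" using k1f by (simp only: floats_uminus_iff)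
    show "- (of_int (k + 1) * w) \<le> - y" using lk by simp
    fix z assume "z \<in> floats p" "z \<le> - y"
    then have "- z \<in> floats p" "y \<le> - z" by (simp_all add: floats_uminus_iff)
    from above[OF this] show "z \<le> - (of_int (k + 1) * w)" by linarith
  qed
  then show "float_down p (- y) = - float_up p y" by (simp only: up)
  have tr: "fl_trunc (p + r) y = of_int \<lfloor>y / v\<rfloor> * v"
    using \<open>y > 0\<close> by (simp add: fl_trunc_def v_def e_def Let_def)
  show "float_down p y < y" "y < float_up p y" using k_less lk by (simp_all add: down up)
  have "w = unit_roundoff p * 2 powi e"
    by (simp add: unit_roundoff_def w_def two_powi_add add.commute add_diff_eq)
  then have "float_up p y - float_down p y = unit_roundoff p * 2 powi e"
    by (simp add: down up distrib_right)
  also have "\<dots> \<le> unit_roundoff p * y" using e1 by (simp add: unit_roundoff_def)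
  finally show "float_up p y - float_down p y \<le> unit_roundoff p * y" .
  \<comment> \<open>\<open>k * w\<close> is also a point of the finer grid, hence truncation cannot
    fall below it.\<close>
  have "k * 2 ^ r \<le> \<lfloor>y / v\<rfloor>" using kle v
    by (simp add: le_floor_iff pos_le_divide_eq wv mult.assoc)
  then have "of_int (k * 2 ^ r) * v \<le> of_int \<lfloor>y / v\<rfloor> * v"
    using v by (intro mult_right_mono iffD2[OF of_int_le_iff]) auto
  then show "float_down p y \<le> fl_trunc (p + r) y"
    by (simp add: down tr wv mult.assoc)
  show "fl_trunc (p + r) y \<le> y" unfolding tr using v
    by (simp add: pos_le_divide_eq[symmetric])
  have "y < of_int (\<lfloor>y / v\<rfloor> + 1) * v" using v by (simp add: pos_divide_less_eq[symmetric])
  then have "y - fl_trunc (p + r) y \<le> v" unfolding tr by (simp add: algebra_simps)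
  also have "v = unit_roundoff (p + r) * 2 powi e"
    by (simp add: unit_roundoff_def v_def two_powi_add add.commute add_diff_eq)
  also have "\<dots> \<le> unit_roundoff (p + r) * y" using e1 by (simp add: unit_roundoff_def)
  finally show "y - fl_trunc (p + r) y \<le> unit_roundoff (p + r) * y" .
qed

text \<open>Negation exchanges the two neighbours and commutes with truncation, which settles
  negative \<open>y\<close>; \<open>y = 0\<close> is excluded as a float.\<close>

lemma rounding_bounds:
  assumes "p > 0" "y \<notin> floats p"
  shows "float_down p y < y" "y < float_up p y"
    "float_up p y - float_down p y \<le> unit_roundoff p * \<bar>y\<bar>"
    "float_down p y \<le> fl_trunc (p + r) y" "fl_trunc (p + r) y \<le> float_up p y"
    "\<bar>fl_trunc (p + r) y - y\<bar> \<le> unit_roundoff (p + r) * \<bar>y\<bar>"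
proof -
  have "y \<noteq> 0"
  proof
    assume "y = 0"
    then have "y = of_int 0 * 2 powi 0" by simp
    then show False using assms(2) unfolding floats_def by fastforce
  qed
  then consider "y > 0" | "- y > 0" by linarith
  then have "float_down p y < y \<and> y < float_up p y \<and>
    float_up p y - float_down p y \<le> unit_roundoff p * \<bar>y\<bar> \<and>
    float_down p y \<le> fl_trunc (p + r) y \<and> fl_trunc (p + r) y \<le> float_up p y \<and>
    \<bar>fl_trunc (p + r) y - y\<bar> \<le> unit_roundoff (p + r) * \<bar>y\<bar>"
  proof cases
    case 1
    then show ?thesis using rounding_bounds_pos(1-3)[OF assms 1] rounding_bounds_pos(4-6)[OF assms 1, of r] by auto
  next
    case 2
    have "- y \<notin> floats p" using assms(2) by (simp add: floats_uminus_iff)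
    note * = rounding_bounds_pos(1-3,7,8)[OF assms(1) this 2] rounding_bounds_pos(4-6)[OF assms(1) this 2, of r]
    show ?thesis using * 2 by (simp add: fl_trunc_uminus)
  qed
  then show "float_down p y < y" "y < float_up p y"
    "float_up p y - float_down p y \<le> unit_roundoff p * \<bar>y\<bar>"
    "float_down p y \<le> fl_trunc (p + r) y" "fl_trunc (p + r) y \<le> float_up p y"
    "\<bar>fl_trunc (p + r) y - y\<bar> \<le> unit_roundoff (p + r) * \<bar>y\<bar>" by auto
qed

section \<open>Size and moment generating function of a single rounding\<close>

lemma unit_roundoff_pos: "unit_roundoff k > 0"
  by (simp add: unit_roundoff_def)

text \<open>Hoeffding's lemma for a centred Bernoulli variable. For \<open>h \<ge> 0\<close> the
  left side is the exponential of the function bounded in \<open>Hoeffdings_lemma_aux\<close>;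
  passing to \<open>- h\<close> and \<open>1 - q\<close> swaps the two summands and covers
  \<open>h < 0\<close>.\<close>

lemma bernoulli_mgf_le:
  fixes h q :: real
  assumes "0 \<le> q" "q \<le> 1"
  shows "q * exp (h * (1 - q)) + (1 - q) * exp (- h * q) \<le> exp (h\<^sup>2 / 8)"
proof -
  have pos: "q * exp (h * (1 - q)) + (1 - q) * exp (- h * q) \<le> exp (h\<^sup>2 / 8)"
    if "h \<ge> 0" "0 \<le> q" "q \<le> 1" for h q :: real
  proof -
    have "1 + q * (exp h - 1) > 0" using that by (intro add_pos_nonneg) auto
    then have "exp (- h * q) * (1 + q * (exp h - 1)) = exp (- h * q + ln (1 + q * (exp h - 1)))"
      by (simp add: exp_diff exp_minus field_simps)
    also have "\<dots> \<le> exp (h\<^sup>2 / 8)" using Hoeffdings_lemma_aux[OF that(1,2)] by simp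
    finally show ?thesis by (simp add: algebra_simps exp_add[symmetric] exp_diff)
  qed
  show ?thesis
  proof (cases "h \<ge> 0")
    case False
    then show ?thesis using pos[of "- h" "1 - q"] assms by (simp add: add.commute)
  qed (use pos assms in auto)
qed

lemma finite_set_SR: "finite (set_pmf (SR p r y))"
  by (simp add: SR_def)

lemma set_SR_abs_le:
  assumes "p > 0" "z \<in> set_pmf (SR p r y)"
  shows "\<bar>z\<bar> \<le> (1 + unit_roundoff p) * \<bar>y\<bar>"
proof (cases "y \<in> floats p")
  case True
  then show ?thesis using assms(2) unit_roundoff_pos[of p] by (simp add: SR_def algebra_simps)
next
  case False
  then have "z = float_up p y \<or> z = float_down p y" using assms(2) by (auto simp: SR_def split: if_splits)
  then have "\<bar>z - y\<bar> \<le> unit_roundoff p * \<bar>y\<bar>"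
    using rounding_bounds(1-3)[OF assms(1) False] by auto
  then show ?thesis by (simp add: algebra_simps)
qed

text \<open>
  The law of \<open>SR p r y\<close> lives on two points at distance at most \<open>u \<bar>y\<bar>\<close> and has mean
  \<open>fl_trunc (p + r) y\<close>, so Hoeffding's lemma applies with a bias of at most \<open>v \<bar>y\<bar>\<close>.
\<close>

lemma SR_mgf_le:
  assumes "p > 0"
  shows "measure_pmf.expectation (SR p r y) (\<lambda>z. exp (l * (z - y)))
    \<le> exp (l\<^sup>2 * (unit_roundoff p * \<bar>y\<bar>)\<^sup>2 / 8 + \<bar>l\<bar> * (unit_roundoff (p + r) * \<bar>y\<bar>))"
proof (cases "y \<in> floats p")
  case True
  then show ?thesis using unit_roundoff_pos[of "p + r"] by (simp add: SR_def)
next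
  case False
  note b = rounding_bounds(1-3)[OF assms False] rounding_bounds(4-6)[OF assms False, of r]
  define lo up T q where "lo = float_down p y" and "up = float_up p y"
    and "T = fl_trunc (p + r) y" and "q = up_prob p r y"
  define w where "w = up - lo"
  have w: "w > 0" "w \<le> unit_roundoff p * \<bar>y\<bar>" using b by (auto simp: w_def lo_def up_def)
  have qw: "q * w = T - lo" using w by (simp add: q_def up_prob_def T_def lo_def w_def up_def)
  have q: "0 \<le> q" "q \<le> 1" using b w
    by (auto simp: q_def up_prob_def field_simps lo_def up_def w_def)
  \<comment> \<open>Each deviation from \<open>y\<close> splits into the bias \<open>T - y\<close>
    and a deviation from the mean \<open>T\<close>: \<open>w * (1 - q)\<close> upwards,
    \<open>- w * q\<close> downwards.\<close>
  have "up - y = (T - y) + w * (1 - q)" using qw by (simp add: algebra_simps w_def)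
  then have up: "exp (l * (up - y)) = exp (l * (T - y)) * exp ((l * w) * (1 - q))"
    by (simp only: exp_add[symmetric] distrib_left mult.assoc)
  have "lo - y = (T - y) + w * (- q)" using qw by (simp add: algebra_simps)
  then have lo: "exp (l * (lo - y)) = exp (l * (T - y)) * exp (- (l * w) * q)"
    by (simp only: exp_add[symmetric] distrib_left mult.assoc) simp
  have "measure_pmf.expectation (SR p r y) (\<lambda>z. exp (l * (z - y)))
      = exp (l * (up - y)) * q + exp (l * (lo - y)) * (1 - q)"
    using False q by (simp add: SR_def q_def up_def lo_def)
  also have "\<dots> = exp (l * (T - y)) * (q * exp ((l * w) * (1 - q)) + (1 - q) * exp (- (l * w) * q))"
    unfolding up lo by (simp only: distrib_left mult_ac)
  also have "\<dots> \<le> exp (l * (T - y)) * exp ((l * w)\<^sup>2 / 8)"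
    by (intro mult_left_mono bernoulli_mgf_le q) auto
  also have "\<dots> = exp (l\<^sup>2 * w\<^sup>2 / 8 + l * (T - y))"
    by (simp add: exp_add[symmetric] power_mult_distrib add.commute)
  also have "\<dots> \<le> exp (l\<^sup>2 * (unit_roundoff p * \<bar>y\<bar>)\<^sup>2 / 8 + \<bar>l\<bar> * (unit_roundoff (p + r) * \<bar>y\<bar>))"
  proof -
    have "l\<^sup>2 * w\<^sup>2 \<le> l\<^sup>2 * (unit_roundoff p * \<bar>y\<bar>)\<^sup>2" using w by (intro mult_left_mono power_mono) auto
    moreover have "l * (T - y) \<le> \<bar>l\<bar> * \<bar>T - y\<bar>" by (metis abs_ge_self abs_mult)
    moreover have "\<dots> \<le> \<bar>l\<bar> * (unit_roundoff (p + r) * \<bar>y\<bar>)"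
      using b(6) by (intro mult_left_mono) (auto simp: T_def)
    ultimately show ?thesis by simp
  qed
  finally show ?thesis .
qed

section \<open>Propagation through rounded affine operations\<close>

lemma expectation_bind_pmf_finite:
  fixes h :: "'b \<Rightarrow> real"
  assumes "finite (set_pmf D)" "\<And>s. s \<in> set_pmf D \<Longrightarrow> finite (set_pmf (f s))"
  shows "measure_pmf.expectation (D \<bind> f) h
    = measure_pmf.expectation D (\<lambda>s. measure_pmf.expectation (f s) h)"
  using assms
  by (subst pmf_expectation_bind[of "set_pmf D"])
     (auto simp: integral_measure_pmf_real[of "set_pmf D"] mult.commute)

text \<open>
  \<open>j\<close> counts the roundings performed so far, \<open>c\<close> is the exact value and \<open>H\<close> the value obtained
  from the absolute values of the data.
\<close>

definition subgaussian_after :: "real \<Rightarrow> real \<Rightarrow> nat \<Rightarrow> real \<Rightarrow> real \<Rightarrow> real pmf \<Rightarrow> bool" where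
  "subgaussian_after u v j H c D \<longleftrightarrow>
     finite (set_pmf D) \<and>
     (\<forall>z\<in>set_pmf D. \<bar>z\<bar> \<le> H * (1 + u) ^ j) \<and>
     (\<forall>l. measure_pmf.expectation D (\<lambda>z. exp (l * (z - c)))
        \<le> exp (l\<^sup>2 * (u\<^sup>2 * H\<^sup>2 * (\<Sum>i<j. (1 + u) ^ (2 * i))) / 8 + \<bar>l\<bar> * (v * H * (\<Sum>i<j. (1 + u) ^ i))))"

text \<open>With \<open>y = m * s + d\<close> the new error is \<open>m * (s - c) + (z - y)\<close>.
  Given \<open>s\<close>, the second summand is controlled by \<open>SR_mgf_le\<close>; the first by
  the hypothesis on \<open>D\<close> at \<open>l * m\<close>, which is why that bound is kept for
  all \<open>l\<close>. Multiplications are the case \<open>d = 0\<close>, additions the case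
  \<open>m = 1\<close>.\<close>

lemma subgaussian_after_SR:
  assumes p: "p > 0"
    and D: "subgaussian_after (unit_roundoff p) (unit_roundoff (p + r)) j H c D" and "H \<ge> 0"
  shows "subgaussian_after (unit_roundoff p) (unit_roundoff (p + r)) (Suc j)
    (\<bar>m\<bar> * H + \<bar>d\<bar>) (m * c + d) (D \<bind> (\<lambda>s. SR p r (m * s + d)))"
proof -
  define u v where "u = unit_roundoff p" and "v = unit_roundoff (p + r)"
  define H' where "H' = \<bar>m\<bar> * H + \<bar>d\<bar>"
  define Q where "Q = (1 + u) ^ j"
  have u: "u > 0" and v: "v > 0" by (simp_all add: u_def v_def unit_roundoff_pos)
  have Q: "Q \<ge> 1" using u by (simp add: Q_def)
  have H': "H' \<ge> 0" "\<bar>m\<bar> * H \<le> H'" using \<open>H \<ge> 0\<close> by (auto simp: H'_def)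
  have fin: "finite (set_pmf D)" using D by (simp add: subgaussian_after_def)
  have Y: "\<bar>m * s + d\<bar> \<le> H' * Q" if "s \<in> set_pmf D" for s
  proof -
    have "\<bar>s\<bar> \<le> H * Q" using D that by (simp add: subgaussian_after_def u_def Q_def)
    then have "\<bar>m\<bar> * \<bar>s\<bar> \<le> \<bar>m\<bar> * (H * Q)" by (intro mult_left_mono) auto
    moreover have "\<bar>m * s + d\<bar> \<le> \<bar>m\<bar> * \<bar>s\<bar> + \<bar>d\<bar>" by (metis abs_mult abs_triangle_ineq)
    moreover have "\<bar>d\<bar> * 1 \<le> \<bar>d\<bar> * Q" using Q by (intro mult_left_mono) auto
    ultimately show ?thesis by (simp add: H'_def algebra_simps)
  qed
  have bd: "\<bar>z\<bar> \<le> H' * (1 + u) ^ Suc j" if "z \<in> set_pmf (D \<bind> (\<lambda>s. SR p r (m * s + d)))" for z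
  proof -
    from that obtain s where s: "s \<in> set_pmf D" "z \<in> set_pmf (SR p r (m * s + d))" by auto
    have "\<bar>z\<bar> \<le> (1 + u) * \<bar>m * s + d\<bar>" using set_SR_abs_le[OF p s(2)] by (simp add: u_def)
    also have "\<dots> \<le> (1 + u) * (H' * Q)" using u Y[OF s(1)] by (intro mult_left_mono) auto
    finally show ?thesis by (simp add: Q_def mult_ac)
  qed
  have mgf: "measure_pmf.expectation (D \<bind> (\<lambda>s. SR p r (m * s + d))) (\<lambda>z. exp (l * (z - (m * c + d))))
    \<le> exp (l\<^sup>2 * (u\<^sup>2 * H'\<^sup>2 * (\<Sum>i<Suc j. (1 + u) ^ (2 * i))) / 8
        + \<bar>l\<bar> * (v * H' * (\<Sum>i<Suc j. (1 + u) ^ i)))" (is "?L \<le> ?R") for l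
  proof -
    define S2 where "S2 = (\<Sum>i<j. (1 + u) ^ (2 * i))"
    define S1 where "S1 = (\<Sum>i<j. (1 + u) ^ i)"
    \<comment> \<open>Bound on the factor from the fresh rounding, uniform in \<open>s\<close>
      thanks to \<open>Y\<close>; it can therefore be pulled out of the outer expectation.\<close>
    define E where "E = exp (l\<^sup>2 * (u * (H' * Q))\<^sup>2 / 8 + \<bar>l\<bar> * (v * (H' * Q)))"
    have S: "S2 \<ge> 0" "S1 \<ge> 0" using u by (auto simp: S2_def S1_def intro!: sum_nonneg)
    have step: "measure_pmf.expectation (SR p r (m * s + d)) (\<lambda>z. exp (l * (z - (m * c + d))))
      \<le> exp (l * m * (s - c)) * E" if "s \<in> set_pmf D" for s
    proof -
      define y where "y = m * s + d"
      have "(\<lambda>z. exp (l * (z - (m * c + d)))) = (\<lambda>z. exp (l * m * (s - c)) * exp (l * (z - y)))"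
        by (simp add: y_def exp_add[symmetric] algebra_simps)
      then have "measure_pmf.expectation (SR p r y) (\<lambda>z. exp (l * (z - (m * c + d))))
        = exp (l * m * (s - c)) * measure_pmf.expectation (SR p r y) (\<lambda>z. exp (l * (z - y)))"
        by simp
      also have "\<dots> \<le> exp (l * m * (s - c)) * exp (l\<^sup>2 * (u * \<bar>y\<bar>)\<^sup>2 / 8 + \<bar>l\<bar> * (v * \<bar>y\<bar>))"
        unfolding u_def v_def by (intro mult_left_mono SR_mgf_le p) auto
      also have "\<dots> \<le> exp (l * m * (s - c)) * E"
      proof -
        have "l\<^sup>2 * (u * \<bar>y\<bar>)\<^sup>2 \<le> l\<^sup>2 * (u * (H' * Q))\<^sup>2"
          using Y[OF that] u by (intro mult_left_mono power_mono) (auto simp: y_def)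
        moreover have "\<bar>l\<bar> * (v * \<bar>y\<bar>) \<le> \<bar>l\<bar> * (v * (H' * Q))"
          using Y[OF that] v by (intro mult_left_mono) (auto simp: y_def)
        ultimately show ?thesis by (simp add: E_def)
      qed
      finally show ?thesis by (simp add: y_def)
    qed
    have "?L = measure_pmf.expectation D (\<lambda>s. measure_pmf.expectation (SR p r (m * s + d))
        (\<lambda>z. exp (l * (z - (m * c + d)))))"
      by (intro expectation_bind_pmf_finite fin finite_set_SR)
    also have "\<dots> \<le> measure_pmf.expectation D (\<lambda>s. exp (l * m * (s - c)) * E)"
      using step by (intro integral_mono_AE integrable_measure_pmf_finite fin) (auto simp: AE_measure_pmf_iff)
    also have "\<dots> = measure_pmf.expectation D (\<lambda>s. exp (l * m * (s - c))) * E" by simp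
    also have "\<dots> \<le> exp ((l * m)\<^sup>2 * (u\<^sup>2 * H\<^sup>2 * S2) / 8 + \<bar>l * m\<bar> * (v * H * S1)) * E"
      using D by (intro mult_right_mono) (auto simp: subgaussian_after_def u_def v_def E_def S2_def S1_def)
    also have "\<dots> \<le> ?R"
    proof -
      \<comment> \<open>Replacing \<open>\<bar>m\<bar> * H\<close> by \<open>H'\<close> in the old
        terms lets them share a factor with \<open>E\<close>, whose contributions
        \<open>Q\<^sup>2\<close> and \<open>Q\<close> are the next terms of the two geometric
        sums.\<close>
      have "(\<bar>m\<bar> * H)\<^sup>2 \<le> H'\<^sup>2" using H' \<open>H \<ge> 0\<close> by (intro power_mono) auto
      then have "(l\<^sup>2 * u\<^sup>2 * S2) * (\<bar>m\<bar> * H)\<^sup>2 \<le> (l\<^sup>2 * u\<^sup>2 * S2) * H'\<^sup>2"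
        using S by (intro mult_left_mono) auto
      moreover have "(\<bar>l\<bar> * v * S1) * (\<bar>m\<bar> * H) \<le> (\<bar>l\<bar> * v * S1) * H'"
        using S v H' by (intro mult_left_mono) auto
      moreover have "?R = exp (l\<^sup>2 * (u\<^sup>2 * H'\<^sup>2 * (S2 + Q\<^sup>2)) / 8 + \<bar>l\<bar> * (v * H' * (S1 + Q)))"
        unfolding sum.lessThan_Suc S1_def S2_def Q_def by (simp add: power_mult[symmetric] mult.commute)
      ultimately show ?thesis
        by (simp add: E_def exp_add[symmetric]
            power_mult_distrib abs_mult algebra_simps add_divide_distrib)
    qed
    finally show ?thesis .
  qed
  show ?thesis
    unfolding subgaussian_after_def using bd mgf fin finite_set_SR
    by (auto simp: u_def v_def H'_def)
qed

section \<open>Tail bound from the moment generating function\<close>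

text \<open>Chernoff's method on each side of \<open>c\<close>. The threshold \<open>B + t\<close>
  contains the bias, so the term linear in \<open>\<bar>l\<bar>\<close> cancels.\<close>

lemma subgaussian_tail:
  fixes D :: "real pmf"
  assumes fin: "finite (set_pmf D)" and "V > 0" "t > 0"
    and mgf: "\<And>l. measure_pmf.expectation D (\<lambda>z. exp (l * (z - c))) \<le> exp (l\<^sup>2 * V / 8 + \<bar>l\<bar> * B)"
  shows "measure_pmf.prob D {z. \<bar>z - c\<bar> > B + t} \<le> 2 * exp (- 2 * t\<^sup>2 / V)"
proof -
  \<comment> \<open>The minimiser of \<open>l\<^sup>2 * V / 8 - l * t\<close>.\<close>
  define l where "l = 4 * t / V"
  have l: "l > 0" using assms by (simp add: l_def)
  have one: "measure_pmf.prob D {z. s * (z - c) \<ge> B + t} \<le> exp (- 2 * t\<^sup>2 / V)"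
    if s: "\<bar>s\<bar> = 1" for s :: real
  proof -
    have "measure_pmf.prob D {z. s * (z - c) \<ge> B + t}
        = measure_pmf.prob D {z \<in> space (measure_pmf D). exp ((l * s) * (z - c)) \<ge> exp (l * (B + t))}"
      using l by (simp add: mult.assoc)
    also have "\<dots> \<le> measure_pmf.expectation D (\<lambda>z. exp ((l * s) * (z - c))) / exp (l * (B + t))"
      by (rule integral_Markov_inequality_measure[where A = "{}"])
         (auto intro: integrable_measure_pmf_finite fin)
    also have "\<dots> \<le> exp ((l * s)\<^sup>2 * V / 8 + \<bar>l * s\<bar> * B) / exp (l * (B + t))"
      by (intro divide_right_mono mgf) auto
    also have "\<dots> = exp (l\<^sup>2 * V / 8 - l * t)"
      using s l abs_square_eq_1[of s] by (simp add: exp_diff[symmetric] power_mult_distrib abs_mult algebra_simps)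
    also have "l\<^sup>2 * V / 8 - l * t = - 2 * t\<^sup>2 / V"
      using \<open>V > 0\<close> by (simp add: l_def power2_eq_square field_simps)
    finally show ?thesis .
  qed
  have "{z. \<bar>z - c\<bar> > B + t} \<subseteq> {z. 1 * (z - c) \<ge> B + t} \<union> {z. (- 1) * (z - c) \<ge> B + t}" by auto
  then have "measure_pmf.prob D {z. \<bar>z - c\<bar> > B + t}
      \<le> measure_pmf.prob D ({z. 1 * (z - c) \<ge> B + t} \<union> {z. (- 1) * (z - c) \<ge> B + t})"
    by (intro measure_pmf.finite_measure_mono) auto
  also have "\<dots> \<le> measure_pmf.prob D {z. 1 * (z - c) \<ge> B + t} + measure_pmf.prob D {z. (- 1) * (z - c) \<ge> B + t}"
    by (intro measure_Un_le) auto
  also have "\<dots> \<le> exp (- 2 * t\<^sup>2 / V) + exp (- 2 * t\<^sup>2 / V)" by (intro add_mono one) auto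
  finally show ?thesis by simp
qed

section \<open>Horner's scheme as a chain of affine operations\<close>

text \<open>The iterate of exact Horner evaluation after \<open>k\<close> rounds; at absolute values
  of the data it supplies \<open>H\<close>.\<close>

definition horner_partial :: "nat \<Rightarrow> (nat \<Rightarrow> real) \<Rightarrow> real \<Rightarrow> nat \<Rightarrow> real" where
  "horner_partial n a x k = (\<Sum>i\<le>k. a (n - k + i) * x ^ i)"

lemma horner_partial_Suc:
  assumes "k < n"
  shows "horner_partial n a x (Suc k) = x * horner_partial n a x k + a (n - Suc k)"
  using assms unfolding horner_partial_def
  by (subst sum.atMost_Suc_shift) (auto simp: sum_distrib_left mult_ac Suc_diff_Suc intro!: sum.cong)

text \<open>Each round is two applications of \<open>subgaussian_after_SR\<close>, first with slope
  \<open>x\<close> and offset 0, then with slope 1 and the next coefficient. The start is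
  deterministic and exact, so both sums begin empty.\<close>

lemma horner_SR_subgaussian:
  assumes "p > 0" "k \<le> n"
  shows "subgaussian_after (unit_roundoff p) (unit_roundoff (p + r)) (2 * k)
    (horner_partial n (\<lambda>i. \<bar>a i\<bar>) \<bar>x\<bar> k) (horner_partial n a x k) (horner_SR p r n a x k)"
  using assms(2)
proof (induction k)
  case 0
  show ?case by (simp add: subgaussian_after_def horner_partial_def)
next
  case (Suc k)
  let ?H = "horner_partial n (\<lambda>i. \<bar>a i\<bar>) \<bar>x\<bar> k"
  have "?H \<ge> 0" by (simp add: horner_partial_def sum_nonneg)
  from Suc subgaussian_after_SR[OF assms(1) _ this, of r "2 * k" _ _ x 0]
  have "subgaussian_after (unit_roundoff p) (unit_roundoff (p + r)) (Suc (2 * k))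
    (\<bar>x\<bar> * ?H) (x * horner_partial n a x k) (horner_SR p r n a x k \<bind> (\<lambda>s. SR p r (x * s)))"
    by simp
  from subgaussian_after_SR[OF assms(1) this, of 1 "a (n - Suc k)"] \<open>?H \<ge> 0\<close> Suc.prems
  show ?case by (simp add: horner_partial_Suc bind_assoc_pmf mult.commute)
qed

section \<open>Geometric sums in terms of \<open>gam\<close>\<close>

text \<open>A geometric series of ratio \<open>(1 + u)\<^sup>2\<close>, where
  \<open>(1 + u)\<^sup>2 - 1 = u * (2 + u)\<close>.\<close>

lemma gam_double_eq_sum: "gam (2 * m) u = u * (2 + u) * (\<Sum>i<m. (1 + u) ^ (2 * i))"
  using power_diff_1_eq[of "(1 + u)\<^sup>2" m]
  by (simp add: gam_def power_mult[symmetric]) (simp add: power2_eq_square algebra_simps)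

lemma gam_diff_ge:
  fixes u v :: real
  assumes "u \<ge> 0" "v \<ge> 0"
  shows "v * (\<Sum>i<m. (1 + u) ^ i) \<le> gam m (u + v) - gam m u"
proof -
  have "v * (\<Sum>i<m. (1 + u) ^ i) \<le> v * (\<Sum>i<m. (1 + u + v) ^ (m - Suc i) * (1 + u) ^ i)"
    using assms by (intro mult_left_mono sum_mono) (auto intro!: mult_left_le_one_le
      simp: one_le_power mult_le_cancel_right1)
  also have "\<dots> = gam m (u + v) - gam m u"
    using power_diff_sumr2[of "1 + u" m "1 + u + v"] by (simp add: gam_def add.assoc)
  finally show ?thesis .
qed



section \<open>From the tail bound to the relative error\<close>

theorem theorem1:
  fixes p r n :: nat and a :: "nat \<Rightarrow> real" and x lam :: real
  assumes "p > 0" and "r > 0" and "n > 0"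
    and "a n \<in> floats p"
    and "poly_val n a x \<noteq> 0"
    and "0 < lam" and "lam < 1"
  shows "measure_pmf.prob (horner_SR p r n a x n)
           {z. \<bar>z - poly_val n a x\<bar> / \<bar>poly_val n a x\<bar>
                 \<le> cond_number n a x *
                    (sqrt (unit_roundoff p * gam (4 * n) (unit_roundoff p)) * sqrt (ln (2 / lam))
                     + gam (2 * n) (unit_roundoff p + unit_roundoff (p + r))
                     - gam (2 * n) (unit_roundoff p))}
         \<ge> 1 - lam"
proof -
  define u v where "u = unit_roundoff p" and "v = unit_roundoff (p + r)"
  define H c D where "H = (\<Sum>i\<le>n. \<bar>a i\<bar> * \<bar>x\<bar> ^ i)" and "c = poly_val n a x"
    and "D = horner_SR p r n a x n"
  define S where "S = (\<Sum>i<2 * n. (1 + u) ^ (2 * i))"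
  define V where "V = u\<^sup>2 * H\<^sup>2 * S"
  define B where "B = v * H * (\<Sum>i<2 * n. (1 + u) ^ i)"
  define t where "t = H * (sqrt (u * gam (4 * n) u) * sqrt (ln (2 / lam)))"
  define G where "G = gam (2 * n) (u + v) - gam (2 * n) u"
  have u: "u > 0" and v: "v > 0" by (simp_all add: u_def v_def unit_roundoff_pos)
  have S: "S > 0" unfolding S_def using u \<open>n > 0\<close> by (intro sum_pos) (auto simp: lessThan_empty_iff)
  have "\<bar>c\<bar> \<le> H" unfolding c_def H_def poly_val_def
    by (rule order_trans[OF sum_abs]) (simp add: abs_mult power_abs)
  moreover have c: "\<bar>c\<bar> > 0" using assms by (simp add: c_def)
  ultimately have H: "H > 0" by linarith
  have ln: "ln (2 / lam) > 0" using assms by simp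
  have gam: "gam (4 * n) u = u * (2 + u) * S"
    using gam_double_eq_sum[of "2 * n" u] by (simp add: S_def)
  have V: "V > 0" using u H S by (simp add: V_def)
  have t: "t > 0" using u H S ln by (simp add: t_def gam)
  \<comment> \<open>\<open>gam (4 * n) u\<close> carries the factor \<open>2 + u\<close> on top of
    the variance proxy \<open>V\<close>.\<close>
  have t2: "t\<^sup>2 = V * (2 + u) * ln (2 / lam)"
    using u S ln by (simp add: t_def V_def gam power_mult_distrib) (simp add: power2_eq_square)
  have "subgaussian_after u v (2 * n) H c D"
    using horner_SR_subgaussian[OF \<open>p > 0\<close> order_refl, of r n a x]
    by (simp add: u_def v_def H_def c_def D_def horner_partial_def poly_val_def)
  then have "measure_pmf.prob D {z. \<bar>z - c\<bar> > B + t} \<le> 2 * exp (- 2 * t\<^sup>2 / V)"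
    using V t by (intro subgaussian_tail) (auto simp: subgaussian_after_def V_def B_def S_def)
  also have "- 2 * t\<^sup>2 / V = - (2 * (2 + u)) * ln (2 / lam)" unfolding t2 using V by (simp add: field_simps)
  \<comment> \<open>The exponent has room to spare: coefficient 1 in place of
    \<open>2 * (2 + u)\<close> already makes the bound equal to \<open>lam\<close>.\<close>
  also have "2 * exp (- (2 * (2 + u)) * ln (2 / lam)) \<le> 2 * exp (- 1 * ln (2 / lam))"
    using u ln by (intro mult_left_mono iffD2[OF exp_le_cancel_iff] mult_right_mono) auto
  also have "\<dots> = lam" using assms by (simp add: exp_minus)
  finally have tail: "measure_pmf.prob D {z. \<bar>z - c\<bar> > B + t} \<le> lam" .
  have "B = H * (v * (\<Sum>i<2 * n. (1 + u) ^ i))" by (simp add: B_def)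
  also have "\<dots> \<le> H * G"
    unfolding G_def using H u v by (intro mult_left_mono gam_diff_ge) auto
  finally have B: "B \<le> H * G" .
  have "1 - lam \<le> 1 - measure_pmf.prob D {z. \<bar>z - c\<bar> > B + t}" using tail by simp
  also have "\<dots> = measure_pmf.prob D (UNIV - {z. \<bar>z - c\<bar> > B + t})"
    using measure_pmf.prob_compl[of "{z. \<bar>z - c\<bar> > B + t}" D] by simp
  also have "\<dots> \<le> measure_pmf.prob D {z. \<bar>z - c\<bar> / \<bar>c\<bar> \<le> H / \<bar>c\<bar>
      * (sqrt (u * gam (4 * n) u) * sqrt (ln (2 / lam)) + gam (2 * n) (u + v) - gam (2 * n) u)}"
  \<comment> \<open>Off the tail event the error is at most \<open>B + t \<le> H * G + t\<close>;
    division by \<open>\<bar>c\<bar>\<close> turns \<open>H\<close> into the condition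
    number.\<close>
  proof (intro measure_pmf.finite_measure_mono subsetI)
    fix z assume "z \<in> UNIV - {z. \<bar>z - c\<bar> > B + t}"
    then have "\<bar>z - c\<bar> \<le> H * G + t" using B by simp
    then have "\<bar>z - c\<bar> / \<bar>c\<bar> \<le> (H * G + t) / \<bar>c\<bar>" using c by (intro divide_right_mono) auto
    then show "z \<in> {z. \<bar>z - c\<bar> / \<bar>c\<bar> \<le> H / \<bar>c\<bar>
      * (sqrt (u * gam (4 * n) u) * sqrt (ln (2 / lam)) + gam (2 * n) (u + v) - gam (2 * n) u)}"
      by (simp add: G_def t_def algebra_simps add_divide_distrib diff_divide_distrib)
  qed auto
  finally show ?thesis
    by (simp add: cond_number_def H_def c_def D_def u_def v_def poly_val_def)
qed

end
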